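(* Let $S$ be a set of $2n$ points in convex position in the plane, where $n \geq 2$. Suppose $F_1, F_2, \ldots, F_n$ are $n$ edge-disjoint non-crossing perfect matchings on $S$. Then $\bigcup_{i=1}^n F_i$ is the convex geometric graph $C_{2n,n}$ on $S$.
   Context: A geometric graph is a graph whose vertex set is a finite set of points in the plane with no three on a common line (general position) and whose edges are straight-line segments joining vertices; it is a convex geometric graph if its vertices are in convex position. Two edges cross if they have a common point that is interior to both of them. A perfect matching on $S$ is a set of segments with endpoints in $S$ such that each point of $S$ is an endpoint of exactly one of them; it is non-crossing if no two of its edges cross. Matchings are edge-disjoint if no two of them have an edge in common. Definition of $C_{2n,n}$ on $S$: label the points of $S$ as $v_0, v_1, \ldots, v_{2n-1}$ in cyclic order around the convex hull. For $i = 0, 1, \ldots, n-1$, let $E_i$ be the set of all edges $v_kv_l$ ($k \ne l$, $k,l\in\{0,\dots,2n-1\}$) with $k+l \equiv 2i+1 \pmod{2n}$. Then $C_{2n,n}$ is the convex geometric graph with vertex set $S$ and edge set $\bigcup_{i=0}^{n-1} E_i$. *)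

theory Defs
  imports "HOL-Analysis.Analysis" "HOL-Number_Theory.Cong"
begin

type_synonym point = "real ^ 2"

(* Every point of S is a vertex of the convex hull of S.  In particular no three
   points of S lie on a common line, since one of them would lie between the others. *)
definition convex_position :: "point set \<Rightarrow> bool" where
  "convex_position S \<longleftrightarrow> finite S \<and> (\<forall>x\<in>S. x \<notin> convex hull (S - {x}))"

(* A non-degenerate segment is represented by the set of its two endpoints,
   a geometric graph by the pair of its vertex set and its edge set. *)
type_synonym seg = "point set"
type_synonym geometric_graph = "point set \<times> seg set"

definition crosses :: "seg \<Rightarrow> seg \<Rightarrow> bool" where
  "crosses e f \<longleftrightarrow>
     (\<exists>a b c d. e = {a, b} \<and> f = {c, d} \<and> open_segment a b \<inter> open_segment c d \<noteq> {})"

definition perfect_matching :: "point set \<Rightarrow> seg set \<Rightarrow> bool" where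
  "perfect_matching S M \<longleftrightarrow>
     (\<forall>e\<in>M. \<exists>a\<in>S. \<exists>b\<in>S. a \<noteq> b \<and> e = {a, b}) \<and>
     (\<forall>x\<in>S. \<exists>!e. e \<in> M \<and> x \<in> e)"

definition non_crossing :: "seg set \<Rightarrow> bool" where
  "non_crossing M \<longleftrightarrow> (\<forall>e\<in>M. \<forall>f\<in>M. e \<noteq> f \<longrightarrow> \<not> crosses e f)"

(* v 0, ..., v (m - 1) are the points of S in cyclic order (in either direction):
   cyclically consecutive points are joined by sides of the convex hull.
   Meaningful for m at least 3. *)
definition cyclic_labelling :: "nat \<Rightarrow> point set \<Rightarrow> (nat \<Rightarrow> point) \<Rightarrow> bool" where
  "cyclic_labelling m S v \<longleftrightarrow>
     bij_betw v {..<m} S \<and>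
     (\<forall>k<m. closed_segment (v k) (v (Suc k mod m)) edge_of (convex hull S))"

definition E_class :: "nat \<Rightarrow> (nat \<Rightarrow> point) \<Rightarrow> nat \<Rightarrow> seg set" where
  "E_class n v i =
     {{v k, v l} | k l. k < 2 * n \<and> l < 2 * n \<and> k \<noteq> l \<and> [k + l = 2 * i + 1] (mod 2 * n)}"

(* C_{2n,n} with respect to the labelling v of its vertices. *)
definition C_graph :: "nat \<Rightarrow> (nat \<Rightarrow> point) \<Rightarrow> geometric_graph" where
  "C_graph n v = (v ` {..<2 * n}, \<Union>i<n. E_class n v i)"

(* G is the graph C_{2n,n} on S.  Its definition starts from a cyclic labelling of S:
   one exists, and the graph does not depend on which one is taken. *)
definition is_C_graph :: "nat \<Rightarrow> point set \<Rightarrow> geometric_graph \<Rightarrow> bool" where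
  "is_C_graph n S G \<longleftrightarrow>
     (\<exists>v. cyclic_labelling (2 * n) S v) \<and>
     (\<forall>v. cyclic_labelling (2 * n) S v \<longrightarrow> G = C_graph n v)"

end

theory Submission
  imports Defs
begin

text \<open>
  The graph C_{2n,n} is the complete bipartite graph between the points with even and the points
  with odd label: a sum \<open>k + l\<close> is congruent to one of 1, 3, ..., 2n-1 modulo 2n exactly when it is
  odd (\<open>C_graph_edge_iff\<close>). Hence it has at most n^2 edges (\<open>C_graph_card_le\<close>).

  An edge of a non-crossing perfect matching joins points of opposite parity. Indeed the points
  whose labels lie strictly between those of the two endpoints can only be matched among
  themselves, since an edge leaving this arc would cross the given edge; so their number is even
  (\<open>non_crossing_matching_edge_odd\<close>). The union of the \<open>F i\<close> is therefore contained in C_{2n,n}. A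
  perfect matching on 2n points has n edges, so by disjointness the union has n^2 edges, and the
  inclusion is an equality.

  The geometric part connects labels with crossings. A cyclic labelling is given only by the fact
  that consecutive points span edges of the convex hull, and the claim needed is that two chords
  with interleaved labels cross (\<open>interleaved_imp_crosses\<close>). Everything is reduced to the signs of
  3-point orientations by one observation about points in convex position: if c and d lie on
  opposite sides of the line ab, then the segments ab and cd meet in their interiors
  (\<open>opposite_sides_imp_open_segments_meet\<close>). Applied to a hull edge cd, which no chord can cross, it
  shows that walking along the labels one never changes sides of a fixed chord ab, so each of
  the two arcs cut off by the chord lies on one side. The two arcs cannot lie on the same side,
  because then ab would be a third hull edge at a, next to the two joining a to its neighbours.

  A cyclic labelling exists because in convex position the other points can be sorted
  by angle around any fixed one (\<open>cyclic_labelling_exists\<close>).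
\<close>

section \<open>Orientation of point triples\<close>

text \<open>Twice the signed area of the triangle abc: positive exactly if abc is a counterclockwise turn.\<close>
definition orient :: "point \<Rightarrow> point \<Rightarrow> point \<Rightarrow> real" where
  "orient a b c = (b$1 - a$1) * (c$2 - a$2) - (b$2 - a$2) * (c$1 - a$1)"

lemma orient_rotate: "orient b c a = orient a b c"
  by (simp add: orient_def algebra_simps)

lemma orient_swap_right: "orient a c b = - orient a b c"
  by (simp add: orient_def algebra_simps)

lemma orient_swap_left: "orient b a c = - orient a b c"
  by (simp add: orient_def algebra_simps)

lemma orient_convex_combination:
  assumes "u + w = 1"
  shows "orient a b (u *\<^sub>R x + w *\<^sub>R y) = u * orient a b x + w * orient a b y"
proof -
  have u: "u = 1 - w" using assms by simp
  show ?thesis unfolding u by (simp add: orient_def algebra_simps)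
qed

lemma orient_zero_imp_on_line:
  assumes "orient a b p = 0" "a \<noteq> b"
  obtains s where "p = a + s *\<^sub>R (b - a)"
proof -
  have e: "(b$1 - a$1) * (p$2 - a$2) = (b$2 - a$2) * (p$1 - a$1)"
    using assms(1) by (simp add: orient_def)
  consider "b$1 - a$1 \<noteq> 0" | "b$2 - a$2 \<noteq> 0"
    using assms(2) by (auto simp: vec_eq_iff forall_2)
  then show thesis
  proof cases
    case 1
    define s where "s = (p$1 - a$1) / (b$1 - a$1)"
    have s: "p$1 - a$1 = s * (b$1 - a$1)" using 1 by (simp add: s_def)
    then have "(b$1 - a$1) * (p$2 - a$2) = (b$1 - a$1) * (s * (b$2 - a$2))"
      using e unfolding s by (simp only: mult_ac)
    then have "p$2 - a$2 = s * (b$2 - a$2)" using 1 by simp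
    then have "p = a + s *\<^sub>R (b - a)" using s by (simp add: vec_eq_iff forall_2)
    then show thesis by (rule that)
  next
    case 2
    define s where "s = (p$2 - a$2) / (b$2 - a$2)"
    have s: "p$2 - a$2 = s * (b$2 - a$2)" using 2 by (simp add: s_def)
    then have "(b$2 - a$2) * (p$1 - a$1) = (b$2 - a$2) * (s * (b$1 - a$1))"
      using e unfolding s by (simp only: mult_ac)
    then have "p$1 - a$1 = s * (b$1 - a$1)" using 2 by simp
    then have "p = a + s *\<^sub>R (b - a)" using s by (simp add: vec_eq_iff forall_2)
    then show thesis by (rule that)
  qed
qed

section \<open>Points in convex position\<close>

lemma convex_position_not_in_hull:
  assumes "convex_position S" "x \<in> S" "T \<subseteq> S" "x \<notin> T"
  shows "x \<notin> convex hull T"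
proof -
  have "convex hull T \<subseteq> convex hull (S - {x})" by (rule hull_mono) (use assms in auto)
  then show ?thesis using assms unfolding convex_position_def by blast
qed

text \<open>
  The position of p on the line ab is recorded through which of the three points is between the
  other two, as convex position forbids such a betweenness among its points.
\<close>
lemma line_point_cases:
  fixes a b :: point
  assumes p: "p = a + s *\<^sub>R (b - a)"
  shows "a \<in> closed_segment p b \<or> p \<in> open_segment a b \<or> b \<in> closed_segment a p \<or> a = b"
proof -
  consider "a = b" | "s \<le> 0" "a \<noteq> b" | "0 < s" "s < 1" "a \<noteq> b" | "1 \<le> s" "a \<noteq> b" by linarith
  then show ?thesis
  proof cases
    case 2
    \<comment> \<open>The equation p = (1 - s) a + s b solved for a; in the last case it is solved for b.\<close>
    define u where "u = (-s) / (1 - s)"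
    have "0 \<le> u" "u \<le> 1" using 2 by (auto simp: u_def field_simps)
    moreover have "(1 - u) *\<^sub>R p + u *\<^sub>R b = ((1 - u) * (1 - s)) *\<^sub>R a + ((1-u) * s + u) *\<^sub>R b"
      unfolding p by (simp add: algebra_simps)
    moreover have "(1 - u) * (1 - s) = 1" "(1 - u) * s + u = 0" using 2 by (auto simp: u_def field_simps)
    ultimately have "a = (1 - u) *\<^sub>R p + u *\<^sub>R b" by simp
    then show ?thesis using \<open>0 \<le> u\<close> \<open>u \<le> 1\<close> unfolding in_segment by blast
  next
    case 3
    have "p = (1 - s) *\<^sub>R a + s *\<^sub>R b" unfolding p by (simp add: algebra_simps)
    then show ?thesis using 3 unfolding in_segment by blast
  next
    case 4
    define u where "u = 1 / s"
    have us: "u * s = 1" "0 \<le> u" "u \<le> 1" using 4 by (auto simp: u_def)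
    have "(1 - u) *\<^sub>R a + u *\<^sub>R p = (1 - u * s) *\<^sub>R a + (u * s) *\<^sub>R b"
      unfolding p by (simp add: algebra_simps)
    then have "b = (1 - u) *\<^sub>R a + u *\<^sub>R p" using us by simp
    then show ?thesis using us unfolding in_segment by blast
  qed simp
qed

lemma convex_position_orient_nonzero:
  assumes S: "convex_position S" and "a \<in> S" "b \<in> S" "c \<in> S" "a \<noteq> b" "b \<noteq> c" "a \<noteq> c"
  shows "orient a b c \<noteq> 0"
proof
  assume "orient a b c = 0"
  then obtain s where s: "c = a + s *\<^sub>R (b - a)" by (rule orient_zero_imp_on_line) (use assms in auto)
  have "a \<notin> closed_segment c b" "c \<notin> closed_segment a b" "b \<notin> closed_segment a c"
    unfolding segment_convex_hull
    by (rule convex_position_not_in_hull[OF S]; use assms in auto)+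
  then show False using line_point_cases[OF s] assms(5) open_closed_segment by blast
qed

text \<open>
  The segment cd meets the line ab in some point p. If p were not strictly between a and b, then
  one of these, say a, would lie between p and b, hence in the triangle bcd, against convex position.
\<close>
lemma opposite_sides_imp_open_segments_meet:
  assumes S: "convex_position S" and "a \<in> S" "b \<in> S" "c \<in> S" "d \<in> S" "a \<noteq> b"
    and opp: "orient a b c * orient a b d < 0"
  shows "open_segment a b \<inter> open_segment c d \<noteq> {}"
proof -
  have ne: "a \<noteq> c" "a \<noteq> d" "b \<noteq> c" "b \<noteq> d" using opp by (auto simp: orient_def)
  have cd: "c \<noteq> d" using opp by (auto simp: mult_less_0_iff)
  \<comment> \<open>The orientation is affine along cd, and t is the parameter at which it vanishes.\<close>
  define t where "t = orient a b c / (orient a b c - orient a b d)"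
  have t: "0 < t" "t < 1" using opp by (auto simp: t_def mult_less_0_iff field_simps)
  define p where "p = (1 - t) *\<^sub>R c + t *\<^sub>R d"
  have pcd: "p \<in> open_segment c d" using t cd by (auto simp: p_def in_segment)
  have "orient a b p = (1 - t) * orient a b c + t * orient a b d"
    unfolding p_def by (rule orient_convex_combination) simp
  also have "\<dots> = 0" using opp by (auto simp: t_def field_simps mult_less_0_iff)
  finally obtain s where s: "p = a + s *\<^sub>R (b - a)" by (rule orient_zero_imp_on_line) (rule \<open>a \<noteq> b\<close>)
  have hull: "closed_segment p x \<subseteq> convex hull {x, c, d}" for x
  proof (rule closed_segment_subset)
    have "p \<in> convex hull {c, d}" using pcd open_closed_segment segment_convex_hull by blast
    then show "p \<in> convex hull {x, c, d}" using hull_mono[of "{c, d}" "{x, c, d}"] by blast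
  qed (auto simp: hull_inc)
  have "a \<notin> convex hull {b, c, d}" "b \<notin> convex hull {a, c, d}"
    by (rule convex_position_not_in_hull[OF S]; use assms ne in auto)+
  then have "p \<in> open_segment a b"
    using line_point_cases[OF s] hull[of a] hull[of b] \<open>a \<noteq> b\<close> closed_segment_commute by blast
  then show ?thesis using pcd by blast
qed

text \<open>
  If a, b, c go counterclockwise once around q, then the three triangle areas are, up to
  normalisation, barycentric coordinates of q with respect to a, b, c. This is the way
  in which convex position enters when points are sorted by angle.
\<close>
lemma not_surrounded:
  assumes S: "convex_position S" and "q \<in> S" "a \<in> S" "b \<in> S" "c \<in> S"
    and pos: "orient q a b > 0" "orient q b c > 0" "orient q c a > 0"
  shows False
proof -
  define W where "W = orient q a b + orient q b c + orient q c a"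
  have W: "W > 0" using pos by (simp add: W_def)
  have "W *\<^sub>R q = orient q b c *\<^sub>R a + orient q c a *\<^sub>R b + orient q a b *\<^sub>R c"
    by (simp add: W_def vec_eq_iff forall_2 orient_def algebra_simps)
  then have "(1 / W) *\<^sub>R (W *\<^sub>R q) = (1 / W) *\<^sub>R (orient q b c *\<^sub>R a + orient q c a *\<^sub>R b + orient q a b *\<^sub>R c)"
    by simp
  then have "q = (orient q b c / W) *\<^sub>R a + (orient q c a / W) *\<^sub>R b + (orient q a b / W) *\<^sub>R c"
    using W by (simp add: scaleR_right_distrib)
  moreover have "orient q b c / W + orient q c a / W + orient q a b / W = 1"
    using W by (simp add: W_def flip: add_divide_distrib)
  moreover have "0 \<le> orient q b c / W" "0 \<le> orient q c a / W" "0 \<le> orient q a b / W"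
    using pos W by auto
  ultimately have "q \<in> convex hull {a, b, c}" unfolding convex_hull_3 by blast
  moreover have "q \<notin> convex hull {a, b, c}"
    using pos by (intro convex_position_not_in_hull[OF S]) (use assms in \<open>auto simp: orient_def\<close>)
  ultimately show False by simp
qed

section \<open>Existence of a cyclic labelling\<close>

text \<open>The position of x in the enumeration is the number of elements below x.\<close>
lemma strict_order_enumeration:
  assumes fin: "finite S"
    and total: "\<And>x y. x \<in> S \<Longrightarrow> y \<in> S \<Longrightarrow> x \<noteq> y \<Longrightarrow> R x y \<or> R y x"
    and irrefl: "\<And>x. x \<in> S \<Longrightarrow> \<not> R x x"
    and trans: "\<And>x y z. x \<in> S \<Longrightarrow> y \<in> S \<Longrightarrow> z \<in> S \<Longrightarrow> R x y \<Longrightarrow> R y z \<Longrightarrow> R x z"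
  obtains v where "bij_betw v {..<card S} S"
    "\<And>i j. i < j \<Longrightarrow> j < card S \<Longrightarrow> R (v i) (v j)"
proof -
  define r where "r x = card {y \<in> S. R y x}" for x
  have less: "r x < r y" if "x \<in> S" "y \<in> S" "R x y" for x y
  proof -
    have "{z \<in> S. R z x} \<subseteq> {z \<in> S. R z y}" using trans that by blast
    moreover have "x \<in> {z \<in> S. R z y}" "x \<notin> {z \<in> S. R z x}" using irrefl that by auto
    ultimately show ?thesis
      unfolding r_def using fin by (intro psubset_card_mono) auto
  qed
  have inj: "inj_on r S"
  proof (rule inj_onI, rule ccontr)
    fix x y assume "x \<in> S" "y \<in> S" "r x = r y" "x \<noteq> y"
    then show False using less[of x y] less[of y x] total[of x y] by auto
  qed
  have "r ` S \<subseteq> {..<card S}"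
  proof
    fix i assume "i \<in> r ` S"
    then obtain x where x: "x \<in> S" "i = r x" by blast
    have "card {y \<in> S. R y x} < card S"
      using fin irrefl[OF x(1)] x(1) by (intro psubset_card_mono) auto
    then show "i \<in> {..<card S}" using x by (simp add: r_def)
  qed
  then have "r ` S = {..<card S}"
    by (intro card_subset_eq) (auto simp: card_image[OF inj])
  then have bij: "bij_betw r S {..<card S}" using inj by (simp add: bij_betw_def)
  show thesis
  proof
    show "bij_betw (inv_into S r) {..<card S} S" by (rule bij_betw_inv_into[OF bij])
    fix i j assume ij: "i < j" "j < card S"
    let ?v = "inv_into S r"
    have S: "?v i \<in> S" "?v j \<in> S" and r: "r (?v i) = i" "r (?v j) = j"
      using ij bij by (auto simp: bij_betw_def inv_into_into f_inv_into_f)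
    have "?v i \<noteq> ?v j" using r ij by auto
    moreover have "\<not> R (?v j) (?v i)" using less[OF S(2,1)] r ij by auto
    ultimately show "R (?v i) (?v j)" using total S by blast
  qed
qed

text \<open>
  The remaining points, and so their hull, stay strictly to one side and miss the line ab. This
  is the criterion for the hull of a subset to be a face of the hull of a finite set.
\<close>
lemma segment_edge_of_hullI:
  assumes "finite S" "a \<in> S" "b \<in> S" "a \<noteq> b"
    and left: "\<And>c. c \<in> S - {a, b} \<Longrightarrow> orient a b c > 0"
  shows "closed_segment a b edge_of (convex hull S)"
proof -
  have line: "orient a b x = 0" if x: "x \<in> affine hull {a, b}" for x
  proof -
    obtain u w where "x = u *\<^sub>R a + w *\<^sub>R b" "u + w = 1"
      using x unfolding affine_hull_2 by blast
    then show ?thesis by (simp add: orient_convex_combination) (simp add: orient_def)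
  qed
  have "convex {x. orient a b x > 0}"
    unfolding convex_def
    by (auto simp: orient_convex_combination) (smt (verit) mult_nonneg_nonneg mult_pos_pos)
  then have "convex hull (S - {a, b}) \<subseteq> {x. orient a b x > 0}"
    by (intro hull_minimal) (use left in auto)
  then have "affine hull {a, b} \<inter> convex hull (S - {a, b}) = {}" using line by fastforce
  then have "convex hull {a, b} face_of convex hull S"
    by (intro face_of_convex_hulls) (use assms in auto)
  moreover have "aff_dim (convex hull {a, b}) = 1"
    using \<open>a \<noteq> b\<close> by (simp add: aff_dim_convex_hull)
  ultimately show ?thesis by (simp add: edge_of_def segment_convex_hull)
qed

text \<open>
  Fix a point p, put it first and order the others by their angle as seen from p. Since no point is
  surrounded by three others, this relation is transitive, and every increasing triple, not
  only those starting at p, is counterclockwise. Hence all other points are to the left of each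
  pair of consecutive points.
\<close>
lemma cyclic_labelling_exists:
  assumes S: "convex_position S" and m: "card S = m" "m \<ge> 3"
  obtains v where "cyclic_labelling m S v"
proof -
  have fin: "finite S" using S by (simp add: convex_position_def)
  obtain p where p: "p \<in> S" using m by fastforce
  note nz = convex_position_orient_nonzero[OF S]
  define R where "R x y \<longleftrightarrow> y \<noteq> p \<and> (x = p \<or> orient p x y > 0)" for x y
  \<comment> \<open>If transitivity failed, x, y and z would surround p.\<close>
  have R_trans: "R x z" if "x \<in> S" "y \<in> S" "z \<in> S" "R x y" "R y z" for x y z
  proof (rule ccontr)
    assume n: "\<not> R x z"
    have "orient p x y > 0" "orient p y z > 0" "\<not> orient p x z > 0" "x \<noteq> p" "y \<noteq> p" "z \<noteq> p"
      using that n by (auto simp: R_def)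
    moreover from this have "x \<noteq> z" by (auto simp: orient_swap_right[of p z y])
    ultimately have "orient p z x > 0" using nz[of p x z] p that by (simp add: orient_swap_right[of p z x])
    then show False using not_surrounded[OF S, of p x y z] p that \<open>orient p x y > 0\<close> \<open>orient p y z > 0\<close>
      by blast
  qed
  have R_total: "R x y \<or> R y x" if "x \<in> S" "y \<in> S" "x \<noteq> y" for x y
  proof (cases "x = p \<or> y = p")
    case True
    then show ?thesis using that by (auto simp: R_def)
  next
    case False
    then have "orient p x y \<noteq> 0" using nz[of p x y] p that by auto
    then show ?thesis using False orient_swap_right[of p y x] by (auto simp: R_def)
  qed
  have R_irrefl: "\<not> R x x" if "x \<in> S" for x by (auto simp: R_def orient_def)
  obtain v where bij: "bij_betw v {..<card S} S"
    and vR: "\<And>i j. i < j \<Longrightarrow> j < card S \<Longrightarrow> R (v i) (v j)"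
    by (rule strict_order_enumeration[OF fin R_total R_irrefl R_trans]) blast+
  have vS: "v i \<in> S" if "i < m" for i using that bij m by (auto simp: bij_betw_def)
  have vinj: "v i = v j \<longleftrightarrow> i = j" if "i < m" "j < m" for i j
    using that bij m by (auto simp: bij_betw_def inj_on_def)
  have ccw: "orient (v i) (v j) (v k) > 0" if "i < j" "j < k" "k < m" for i j k
  proof (cases "v i = p")
    case True
    have "R (v j) (v k)" "v j \<noteq> v i" using vR m that vinj by auto
    then show ?thesis using True by (simp add: R_def)
  next
    case False
    have R: "R (v i) (v j)" "R (v j) (v k)" using vR m that by auto
    then have pos: "orient p (v i) (v j) > 0" "orient p (v j) (v k) > 0"
      using False by (auto simp: R_def)
    show ?thesis
    proof (rule ccontr)
      assume "\<not> ?thesis"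
      \<comment> \<open>In this case p, v i and v k surround v j.\<close>
      then have "orient (v j) (v i) (v k) > 0"
        using nz[of "v i" "v j" "v k"] vS vinj that by (simp add: orient_swap_left[of "v j" "v i"])
      then show False
        using not_surrounded[OF S, of "v j" p "v i" "v k"] vS p that pos
        by (simp add: orient_rotate)
    qed
  qed
  have "closed_segment (v k) (v (Suc k mod m)) edge_of (convex hull S)" if k: "k < m" for k
  proof (rule segment_edge_of_hullI[OF fin])
    let ?l = "Suc k mod m"
    have l: "?l < m" using m by simp
    show "v k \<in> S" "v ?l \<in> S" using vS k l by auto
    have "k \<noteq> ?l" using k m by (cases "Suc k = m") auto
    then show "v k \<noteq> v ?l" using vinj k l by blast
    fix c assume c: "c \<in> S - {v k, v ?l}"
    then obtain i where i: "i < m" "c = v i" using bij m by (auto simp: bij_betw_def)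
    then have ne: "i \<noteq> k" "i \<noteq> ?l" using c by auto
    show "orient (v k) (v ?l) c > 0"
    proof (cases "Suc k = m")
      case True
      then have "0 < i" "i < k" using ne i by auto
      then show ?thesis using ccw[of 0 i k] k i True by (simp add: orient_rotate)
    next
      case False
      then have sl: "?l = Suc k" using k by simp
      show ?thesis
      proof (cases "i < k")
        case True
        then show ?thesis using ccw[of i k "Suc k"] sl l i by (simp add: orient_rotate)
      next
        case False
        then show ?thesis using ccw[of k "Suc k" i] sl ne i by simp
      qed
    qed
  qed
  then have "cyclic_labelling m S v" using bij m by (simp add: cyclic_labelling_def)
  then show thesis by (rule that)
qed

section \<open>Crossing chords in a cyclic labelling\<close>

text \<open>
  The line ab has the remaining points of S strictly on one side. For points in convex position
  these are the lines through the hull edges; the product condition avoids choosing a side.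
\<close>
definition supporting :: "point set \<Rightarrow> point \<Rightarrow> point \<Rightarrow> bool" where
  "supporting S a b \<longleftrightarrow> (\<forall>c\<in>S - {a, b}. \<forall>d\<in>S - {a, b}. orient a b c * orient a b d > 0)"

lemma supporting_commute: "supporting S b a \<longleftrightarrow> supporting S a b"
  by (simp add: supporting_def orient_swap_left[of b a] insert_commute)

text \<open>
  The segment ab is a face of the hull, so a segment of the hull whose interior meets it has its
  endpoints on it; but convex position keeps c and d off the segment ab.
\<close>
lemma edge_of_hull_not_crossed:
  assumes S: "convex_position S" and "a \<in> S" "b \<in> S" "a \<noteq> b" "c \<in> S - {a, b}" "d \<in> S - {a, b}"
    and e: "closed_segment a b edge_of (convex hull S)"
  shows "open_segment a b \<inter> open_segment c d = {}"
proof (rule ccontr)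
  assume "\<not> ?thesis"
  then obtain x where x: "x \<in> closed_segment a b" "x \<in> open_segment c d"
    using open_closed_segment by blast
  have "closed_segment a b face_of (convex hull S)" using e by (simp add: edge_of_def)
  moreover have "c \<in> convex hull S" "d \<in> convex hull S" using assms by (auto simp: hull_inc)
  ultimately have "c \<in> closed_segment a b" using x unfolding face_of_def by blast
  moreover have "c \<notin> convex hull {a, b}" by (rule convex_position_not_in_hull[OF S]) (use assms in auto)
  ultimately show False by (simp add: segment_convex_hull)
qed

lemma edge_of_hull_supporting:
  assumes S: "convex_position S" and ab: "a \<in> S" "b \<in> S" "a \<noteq> b"
    and e: "closed_segment a b edge_of (convex hull S)"
  shows "supporting S a b"
  unfolding supporting_def
proof (intro ballI)
  fix c d assume cd: "c \<in> S - {a, b}" "d \<in> S - {a, b}"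
  have "orient a b c \<noteq> 0" "orient a b d \<noteq> 0"
    using convex_position_orient_nonzero[OF S] ab cd by auto
  moreover have "\<not> orient a b c * orient a b d < 0"
    using opposite_sides_imp_open_segments_meet[OF S, of a b c d]
      edge_of_hull_not_crossed[OF S ab cd e] ab cd by blast
  ultimately show "orient a b c * orient a b d > 0"
    by (metis linorder_neqE_linordered_idom mult_eq_0_iff)
qed

text \<open>
  Write [yz] for the sign of the orientation of x, y, z. The hypotheses say [pq] = [pr], [qp] = [qr]
  and [rp] = [rq]. By antisymmetry [qr] = -[pq] and [rq] = -[pr] = -[pq], so [qr] = [rq],
  which is impossible for nonzero antisymmetric signs.
\<close>
lemma at_most_two_supporting:
  assumes "supporting S x p" "supporting S x q" "supporting S x r"
    and "p \<in> S" "q \<in> S" "r \<in> S" "p \<noteq> x" "q \<noteq> x" "r \<noteq> x" "p \<noteq> q" "q \<noteq> r" "p \<noteq> r"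
  shows False
proof -
  have "orient x p q * orient x p r > 0" "orient x q p * orient x q r > 0"
    "orient x r p * orient x r q > 0"
    using assms by (auto simp: supporting_def)
  then show False
    unfolding orient_swap_right[of x q p] orient_swap_right[of x r p] orient_swap_right[of x r q]
    by (auto simp only: zero_less_mult_iff neg_less_0_iff_less neg_0_less_iff_less)
qed

text \<open>
  Consecutive points of the arc span a hull edge, and the chord ab does not cross it; so they lie
  on the same side of ab. Indices are taken modulo m so that the arc may pass the label 0.
\<close>
lemma arc_on_one_side:
  assumes S: "convex_position S" and v: "cyclic_labelling m S v" and m: "m \<ge> 3"
    and a: "a \<in> S" and b: "b \<in> S" and ab: "a \<noteq> b"
    and avoid: "\<And>t. t \<le> N \<Longrightarrow> v ((s + t) mod m) \<noteq> a \<and> v ((s + t) mod m) \<noteq> b"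
    and t: "t \<le> N"
  shows "orient a b (v (s mod m)) * orient a b (v ((s + t) mod m)) > 0"
  using t
proof (induction t)
  case 0
  have "v (s mod m) \<in> S" using v m by (auto simp: cyclic_labelling_def bij_betw_def)
  then have "orient a b (v (s mod m)) \<noteq> 0"
    using convex_position_orient_nonzero[OF S, of a b "v (s mod m)"] a b ab avoid[of 0] by auto
  then show ?case by (auto simp: zero_less_mult_iff)
next
  case (Suc t)
  let ?c = "v ((s + t) mod m)" and ?d = "v ((s + Suc t) mod m)"
  have bij: "bij_betw v {..<m} S" using v by (simp add: cyclic_labelling_def)
  have cS: "?c \<in> S" "?d \<in> S" using bij m by (auto simp: bij_betw_def)
  have d: "(s + Suc t) mod m = Suc ((s + t) mod m) mod m" by (simp add: mod_Suc_eq)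
  have "(s + t) mod m \<noteq> (s + Suc t) mod m"
    unfolding d using m mod_less_divisor[of m "s + t"] mod_less[of "Suc ((s + t) mod m)" m]
    by (cases "Suc ((s + t) mod m) = m") (auto simp del: mod_less_divisor)
  then have "?c \<noteq> ?d" using bij m by (auto simp: bij_betw_def inj_on_def)
  have "closed_segment ?c ?d edge_of (convex hull S)"
    unfolding d using v m by (auto simp: cyclic_labelling_def)
  then have "open_segment ?c ?d \<inter> open_segment a b = {}"
    using edge_of_hull_not_crossed[OF S cS \<open>?c \<noteq> ?d\<close>, of a b] avoid[of t] avoid[of "Suc t"] Suc.prems a b
    by auto
  then have "\<not> orient a b ?c * orient a b ?d < 0"
    using opposite_sides_imp_open_segments_meet[OF S a b cS ab] by blast
  moreover have "orient a b ?d \<noteq> 0"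
    using convex_position_orient_nonzero[OF S a b cS(2)] ab avoid[of "Suc t"] Suc.prems by auto
  moreover have "orient a b (v (s mod m)) * orient a b ?c > 0" using Suc by simp
  ultimately show ?case by (auto simp: zero_less_mult_iff mult_less_0_iff)
qed

text \<open>
  The chord splits the remaining points into two arcs, each on one side of it. If both arcs were
  on the same side, the chord would support S at v k just as the hull edges from v k to its
  two neighbours do. As both arcs are nonempty, these are three different chords at v k, one too many.
\<close>
lemma interleaved_imp_crosses:
  assumes S: "convex_position S" and v: "cyclic_labelling m S v"
    and idx: "k < i" "i < l" "l < m" "j < m" "j < k \<or> l < j"
  shows "crosses {v k, v l} {v i, v j}"
proof -
  have m: "m \<ge> 3" using idx by linarith
  have bij: "bij_betw v {..<m} S"
    and edge: "\<And>k. k < m \<Longrightarrow> closed_segment (v k) (v (Suc k mod m)) edge_of (convex hull S)"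
    using v by (auto simp: cyclic_labelling_def)
  have vS: "v i \<in> S" if "i < m" for i using that bij by (auto simp: bij_betw_def)
  have vinj: "v i = v j \<longleftrightarrow> i = j" if "i < m" "j < m" for i j
    using that bij by (auto simp: bij_betw_def inj_on_def)
  define a b where "a = v k" and "b = v l"
  have ab: "a \<in> S" "b \<in> S" "a \<noteq> b" using vS vinj idx by (auto simp: a_def b_def)
  have inner: "orient a b (v (Suc k)) * orient a b (v h) > 0" if h: "k < h" "h < l" for h
  proof -
    have "orient a b (v (Suc k mod m)) * orient a b (v ((Suc k + (h - Suc k)) mod m)) > 0"
    proof (rule arc_on_one_side[OF S v m ab, where N = "l - k - 2"])
      fix t assume "t \<le> l - k - 2"
      then have "Suc k + t < l" using idx by linarith
      then show "v ((Suc k + t) mod m) \<noteq> a \<and> v ((Suc k + t) mod m) \<noteq> b"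
        using vinj idx by (auto simp: a_def b_def)
    qed (use h in linarith)
    then show ?thesis using h idx by simp
  qed
  \<comment> \<open>The outer arc starts at l + 1 and has m - l + k - 1 points, hence the bound on the offset t.\<close>
  have outer: "orient a b (v (Suc l mod m)) * orient a b (v h) > 0" if h: "h < m" "h < k \<or> l < h" for h
  proof -
    have wrap: "(Suc l + t) mod m = (if Suc l + t < m then Suc l + t else Suc l + t - m)"
      if "t \<le> k + m - l - 2" for t
      using that idx by (auto simp: mod_if)
    define t where "t = (if l < h then h - Suc l else h + m - Suc l)"
    have t: "t \<le> k + m - l - 2" "(Suc l + t) mod m = h"
      using h idx by (auto simp: t_def)
    have "orient a b (v (Suc l mod m)) * orient a b (v ((Suc l + t) mod m)) > 0"
    proof (rule arc_on_one_side[OF S v m ab _ t(1)])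
      fix t assume t: "t \<le> k + m - l - 2"
      have "(Suc l + t) mod m \<noteq> k" "(Suc l + t) mod m \<noteq> l" "(Suc l + t) mod m < m"
        using wrap[OF t] t idx by auto
      then show "v ((Suc l + t) mod m) \<noteq> a \<and> v ((Suc l + t) mod m) \<noteq> b"
        using vinj idx by (auto simp: a_def b_def)
    qed
    then show ?thesis using t by simp
  qed
  have "orient a b (v i) * orient a b (v j) < 0"
  proof (rule ccontr)
    assume nlt: "\<not> ?thesis"
    have same: "orient a b (v h) * orient a b (v i) > 0" if "h < m" "h \<noteq> k" "h \<noteq> l" for h
    proof (cases "k < h \<and> h < l")
      case True
      then show ?thesis using inner[of h] inner[of i] idx by (auto simp: zero_less_mult_iff)
    next
      case False
      then show ?thesis using outer[of h] outer[of j] inner[of i] idx that nlt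
        by (auto simp: zero_less_mult_iff mult_less_0_iff)
    qed
    have "supporting S a b"
      unfolding supporting_def
    proof (intro ballI)
      fix c d assume "c \<in> S - {a, b}" "d \<in> S - {a, b}"
      then obtain g h where "c = v g" "d = v h" "g < m" "h < m" "g \<noteq> k" "g \<noteq> l" "h \<noteq> k" "h \<noteq> l"
        using bij by (auto simp: bij_betw_def a_def b_def)
      then show "orient a b c * orient a b d > 0"
        using same[of g] same[of h] by (auto simp: zero_less_mult_iff)
    qed
    moreover have "supporting S a (v (Suc k))"
      using edge_of_hull_supporting[OF S, of a "v (Suc k)"] edge[of k] vS vinj idx
      by (simp add: a_def)
    moreover define k' where "k' = (if k = 0 then m - 1 else k - 1)"
    have k': "k' < m" "Suc k' mod m = k" "k' \<noteq> k" "k' \<noteq> Suc k" "k' \<noteq> l"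
      using idx by (auto simp: k'_def)
    have "supporting S (v k') a"
      using edge_of_hull_supporting[OF S, of "v k'" a] edge[of k'] vS vinj idx k'
      by (simp add: a_def)
    ultimately show False
      using at_most_two_supporting[of S a b "v (Suc k)" "v k'"] k' idx vS vinj ab
      by (simp add: supporting_commute a_def b_def)
  qed
  then have "open_segment a b \<inter> open_segment (v i) (v j) \<noteq> {}"
    by (intro opposite_sides_imp_open_segments_meet[OF S]) (use ab vS idx in auto)
  then show ?thesis unfolding crosses_def a_def b_def by blast
qed

section \<open>Edges of a non-crossing perfect matching\<close>

lemma perfect_matching_edgeE:
  assumes "perfect_matching S M" "e \<in> M"
  obtains a b where "a \<in> S" "b \<in> S" "a \<noteq> b" "e = {a, b}"
proof -
  have "\<exists>a\<in>S. \<exists>b\<in>S. a \<noteq> b \<and> e = {a, b}"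
    using assms by (simp add: perfect_matching_def)
  then show thesis using that by blast
qed

lemma perfect_matching_coverE:
  assumes "perfect_matching S M" "x \<in> S"
  obtains e where "e \<in> M" "x \<in> e"
proof -
  have "\<exists>!e. e \<in> M \<and> x \<in> e" using assms by (simp add: perfect_matching_def)
  then show thesis using that by (elim ex1E conjE)
qed

lemma perfect_matching_unique:
  assumes "perfect_matching S M" "e \<in> M" "f \<in> M" "x \<in> e" "x \<in> f"
  shows "e = f"
proof -
  have "x \<in> S" using assms by (auto elim: perfect_matching_edgeE)
  then have "\<exists>!e. e \<in> M \<and> x \<in> e" using assms(1) by (simp add: perfect_matching_def)
  then show ?thesis using assms by (auto elim: ex1E)
qed

text \<open>
  A set of vertices that no matching edge leaves is the disjoint union of the edges inside it. This
  is used for all of S, giving the size of a perfect matching, and for the arc cut off by an edge.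
\<close>
lemma card_of_matched_set:
  assumes M: "perfect_matching S M" and fin: "finite S" and "A \<subseteq> S"
    and closed: "\<And>e x. e \<in> M \<Longrightarrow> x \<in> e \<Longrightarrow> x \<in> A \<Longrightarrow> e \<subseteq> A"
  shows "card A = 2 * card {e \<in> M. e \<subseteq> A}"
proof -
  let ?N = "{e \<in> M. e \<subseteq> A}"
  have "\<Union>?N = A"
  proof
    show "A \<subseteq> \<Union>?N"
    proof
      fix x assume "x \<in> A"
      then obtain e where "e \<in> M" "x \<in> e" using perfect_matching_coverE[OF M] \<open>A \<subseteq> S\<close> by blast
      then show "x \<in> \<Union>?N" using closed \<open>x \<in> A\<close> by blast
    qed
  qed auto
  have pairs: "card e = 2" if e: "e \<in> ?N" for e
  proof -
    have "e \<in> M" using e by simp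
    then obtain a b where "a \<noteq> b" "e = {a, b}" by (rule perfect_matching_edgeE[OF M])
    then show ?thesis by simp
  qed
  have "pairwise disjnt ?N"
    unfolding pairwise_def disjnt_def using perfect_matching_unique[OF M] by blast
  then have "card (\<Union>?N) = sum card ?N"
    by (rule card_Union_disjoint) (metis pairs card.infinite zero_neq_numeral)
  also have "\<dots> = 2 * card ?N" using pairs by simp
  finally show ?thesis using \<open>\<Union>?N = A\<close> by simp
qed

lemma perfect_matching_card:
  assumes M: "perfect_matching S M" and fin: "finite S"
  shows "card S = 2 * card M"
proof -
  have sub: "e \<subseteq> S" if "e \<in> M" for e using perfect_matching_edgeE[OF M that] by blast
  then have "{e \<in> M. e \<subseteq> S} = M" by auto
  then show ?thesis using card_of_matched_set[OF M fin, of S] sub by auto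
qed

text \<open>
  No matching edge leads out of the arc of the l - k - 1 points strictly between v k and v l: it would
  end in v k or v l, which are already matched with each other, or cross the edge joining
  them. So l - k - 1 is even.
\<close>
lemma non_crossing_matching_edge_odd:
  assumes S: "convex_position S" and v: "cyclic_labelling m S v"
    and M: "perfect_matching S M" and nc: "non_crossing M"
    and e: "{v k, v l} \<in> M" and kl: "k < l" "l < m"
  shows "odd (k + l)"
proof -
  have bij: "bij_betw v {..<m} S" using v by (simp add: cyclic_labelling_def)
  have inj: "inj_on v {..<m}" and SV: "S = v ` {..<m}" using bij by (auto simp: bij_betw_def)
  define A where "A = v ` {k<..<l}"
  have AS: "A \<subseteq> S" using kl by (auto simp: A_def SV)
  have kA: "v k \<notin> A" "v l \<notin> A" using inj kl unfolding A_def inj_on_def by fastforce+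
  have "f \<subseteq> A" if f: "f \<in> M" and x: "x \<in> f" "x \<in> A" for f x
  proof
    fix y assume y: "y \<in> f"
    have fne: "f \<noteq> {v k, v l}" using x kA by auto
    have fpair: "f = {x, y}" if "x \<noteq> y"
      using perfect_matching_edgeE[OF M f] x y that by blast
    obtain i where i: "k < i" "i < l" "x = v i" using x by (auto simp: A_def)
    show "y \<in> A"
    proof (rule ccontr)
      assume yA: "y \<notin> A"
      then have "x \<noteq> y" using x by auto
      have "y \<in> S" using perfect_matching_edgeE[OF M f] y by blast
      then obtain j where j: "j < m" "y = v j" by (auto simp: SV)
      have "y \<noteq> v k" "y \<noteq> v l"
        using perfect_matching_unique[OF M f e y] fne by blast+
      then have "j \<noteq> k" "j \<noteq> l" "\<not> (k < j \<and> j < l)" using yA j by (auto simp: A_def)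
      then have "j < k \<or> l < j" by linarith
      then have "crosses {v k, v l} f"
        using interleaved_imp_crosses[OF S v i(1,2) kl(2) j(1)] fpair[OF \<open>x \<noteq> y\<close>] i j by simp
      moreover have "\<not> crosses {v k, v l} f"
        using nc e f fne[symmetric] unfolding non_crossing_def by simp
      ultimately show False by simp
    qed
  qed
  then have "card A = 2 * card {e \<in> M. e \<subseteq> A}"
    using card_of_matched_set[OF M _ AS] S by (auto simp: convex_position_def)
  moreover have "card A = l - k - 1"
    unfolding A_def by (subst card_image) (use inj kl in \<open>auto intro: inj_on_subset\<close>)
  ultimately have "even (l - k - 1)" by simp
  then show ?thesis using kl by presburger
qed

section \<open>Counting edges\<close>

text \<open>
  The modulus 2n is even, so the congruence determines the parity of k + l. Conversely an
  odd sum has an odd residue below 2n, which is 2i + 1 for some i below n.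
\<close>
lemma C_graph_edge_iff:
  "e \<in> (\<Union>i<n. E_class n v i) \<longleftrightarrow> (\<exists>k l. k < 2 * n \<and> l < 2 * n \<and> odd (k + l) \<and> e = {v k, v l})"
proof
  assume "e \<in> (\<Union>i<n. E_class n v i)"
  then obtain i k l where kl: "k < 2 * n" "l < 2 * n" "e = {v k, v l}" "[k + l = 2 * i + 1] (mod 2 * n)"
    unfolding E_class_def by blast
  have "[k + l = 2 * i + 1] (mod 2)" using kl(4) cong_dvd_modulus_nat dvd_triv_left by blast
  then have "odd (k + l)" by (simp add: cong_def) presburger
  then show "\<exists>k l. k < 2 * n \<and> l < 2 * n \<and> odd (k + l) \<and> e = {v k, v l}" using kl by blast
next
  assume "\<exists>k l. k < 2 * n \<and> l < 2 * n \<and> odd (k + l) \<and> e = {v k, v l}"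
  then obtain k l where kl: "k < 2 * n" "l < 2 * n" "odd (k + l)" "e = {v k, v l}" by blast
  define i where "i = (k + l) mod (2 * n) div 2"
  have "odd ((k + l) mod (2 * n))" using kl(3) by (simp add: dvd_mod_iff)
  then have "(k + l) mod (2 * n) = 2 * i + 1" by (simp add: i_def)
  moreover have "(k + l) mod (2 * n) < 2 * n" using kl by simp
  ultimately have "i < n" "[k + l = 2 * i + 1] (mod 2 * n)" by (auto simp: cong_def)
  moreover have "k \<noteq> l" using kl(3) by auto
  ultimately show "e \<in> (\<Union>i<n. E_class n v i)" using kl unfolding E_class_def by blast
qed

text \<open>Each edge is determined by its endpoint with even label and its endpoint with odd label.\<close>
lemma C_graph_card_le:
  "finite (\<Union>i<n. E_class n v i)" "card (\<Union>i<n. E_class n v i) \<le> n * n"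
proof -
  let ?f = "\<lambda>(i, j). {v (2 * i), v (2 * j + 1)}"
  have sub: "(\<Union>i<n. E_class n v i) \<subseteq> ?f ` ({..<n} \<times> {..<n})"
  proof
    fix e assume "e \<in> (\<Union>i<n. E_class n v i)"
    then obtain k l where kl: "k < 2 * n" "l < 2 * n" "odd (k + l)" "e = {v k, v l}"
      unfolding C_graph_edge_iff by blast
    then obtain k l where kl: "k < 2 * n" "l < 2 * n" "even k" "odd l" "e = {v k, v l}"
      by (cases "even k") (auto simp: insert_commute)
    then have "e = ?f (k div 2, l div 2)" "k div 2 < n" "l div 2 < n" by auto
    then show "e \<in> ?f ` ({..<n} \<times> {..<n})" by blast
  qed
  have fin: "finite (?f ` ({..<n} \<times> {..<n}))" by simp
  show "finite (\<Union>i<n. E_class n v i)" by (rule finite_subset[OF sub fin])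
  have "card (?f ` ({..<n} \<times> {..<n})) \<le> n * n"
    using card_image_le[of "{..<n} \<times> {..<n}" ?f] by simp
  with card_mono[OF fin sub] show "card (\<Union>i<n. E_class n v i) \<le> n * n" by (rule order_trans)
qed

theorem theorem1:
  fixes n :: nat and S :: "point set" and F :: "nat \<Rightarrow> seg set"
  assumes "n \<ge> 2"
    and "card S = 2 * n"
    and "convex_position S"
    and "\<And>i. i \<in> {1..n} \<Longrightarrow> perfect_matching S (F i)"
    and "\<And>i. i \<in> {1..n} \<Longrightarrow> non_crossing (F i)"
    and "\<And>i j. i \<in> {1..n} \<Longrightarrow> j \<in> {1..n} \<Longrightarrow> i \<noteq> j \<Longrightarrow> F i \<inter> F j = {}"
  shows "is_C_graph n S (S, \<Union>i\<in>{1..n}. F i)"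
proof -
  have fin: "finite S" using assms(3) by (simp add: convex_position_def)
  have cardF: "card (F i) = n" if "i \<in> {1..n}" for i
    using perfect_matching_card[OF assms(4)[OF that] fin] assms(2) by simp
  have finF: "finite (F i)" if "i \<in> {1..n}" for i
    using cardF[OF that] assms(1) card.infinite by fastforce
  have "card (\<Union>i\<in>{1..n}. F i) = (\<Sum>i\<in>{1..n}. card (F i))"
    by (rule card_UN_disjoint) (use finF assms(6) in auto)
  also have "\<dots> = n * n" using cardF by simp
  finally have card: "card (\<Union>i\<in>{1..n}. F i) = n * n" .
  have "(S, \<Union>i\<in>{1..n}. F i) = C_graph n v" if v: "cyclic_labelling (2 * n) S v" for v
  proof -
    have SV: "S = v ` {..<2 * n}" using v by (auto simp: cyclic_labelling_def bij_betw_def)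
    have "(\<Union>i\<in>{1..n}. F i) \<subseteq> (\<Union>i<n. E_class n v i)"
    proof
      fix e assume "e \<in> (\<Union>i\<in>{1..n}. F i)"
      then obtain i where i: "i \<in> {1..n}" "e \<in> F i" by blast
      then obtain a b where ab: "a \<in> S" "b \<in> S" "a \<noteq> b" "e = {a, b}"
        by (rule perfect_matching_edgeE[OF assms(4)])
      then obtain k l where kl: "k < 2 * n" "l < 2 * n" "k \<noteq> l" "e = {v k, v l}" by (auto simp: SV)
      note odd = non_crossing_matching_edge_odd[OF assms(3) v assms(4)[OF i(1)] assms(5)[OF i(1)]]
      have "odd (k + l)"
      proof (cases "k < l")
        case True
        then show ?thesis using odd kl i by blast
      next
        case False
        then have "l < k" using kl by simp
        then have "odd (l + k)" using odd[of l k] kl i by (simp add: insert_commute)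
        then show ?thesis by (simp add: add.commute)
      qed
      then show "e \<in> (\<Union>i<n. E_class n v i)" unfolding C_graph_edge_iff using kl by blast
    qed
    then have "(\<Union>i\<in>{1..n}. F i) = (\<Union>i<n. E_class n v i)"
      using card_seteq[OF C_graph_card_le(1)] C_graph_card_le(2) by (simp only: card)
    then show ?thesis using SV by (simp add: C_graph_def)
  qed
  moreover obtain v where "cyclic_labelling (2 * n) S v"
    by (rule cyclic_labelling_exists[OF assms(3,2)]) (use assms(1) in auto)
  ultimately show ?thesis unfolding is_C_graph_def by blast
qed

end
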